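(* Let $\mathbb{Z}^d\curvearrowright\mathbb{T}^k$ be a free action by translations (the $i$-th standard generator acts by translation by some $x_i\in\mathbb{T}^k$), and let $G$ be its Schreier graph with respect to the generating set $S=\{\gamma\in\mathbb{Z}^d : \|\gamma\|_\infty=1\}$. For any $q\in\mathbb{N}$ there is a $q$-toast $(T_n)_{n\in\mathbb{N}}$ for $G$ with each layer $T_n$ a $\boldsymbol{\Delta}^0_2$ subset of $\mathbb{T}^k$.
   Context: $\mathbb{T}^k=\mathbb{R}^k/\mathbb{Z}^k$. A set is $\boldsymbol{\Delta}^0_2$ if it is both $F_\sigma$ and $G_\delta$. For an action $\Gamma\curvearrowright X$ and a finite symmetric generating set $S$ of $\Gamma$, the Schreier graph $G$ has vertex set $X$ and edges $(x,\gamma\cdot x)$ for $x\in X$, $\gamma\in S$. $\operatorname{dist}$ is the graph distance in $G$ ($\infty$ between different components); distances between sets are infima. $G^{\le q}$ is the graph on $X$ in which $x,y$ are adjacent iff $\operatorname{dist}(x,y)\le q$; $G\upharpoonright Y$ is the induced subgraph on $Y\subseteq X$. The interior boundary of $R\subseteq X$ is $\partial_iR=\{x\in R : \operatorname{dist}(x,X\setminus R)\le1\}$. A $q$-toast for $G$ is a sequence $(T_n)_{n\in\mathbb{N}}$ of subsets of $X$ (called layers) such that: (1) $\bigcup_nT_n=X$; (2) for each $n$, the connected components of $G^{\le q}\upharpoonright T_n$ have uniformly bounded diameter (with respect to $\operatorname{dist}$); (3) for all $n<m$, $\operatorname{dist}(T_n,\partial_iT_m)\ge q$. *)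

theory Defs
  imports "HOL-Analysis.Analysis"
begin

section \<open>The torus\<close>

quotient_type (overloaded) 'k torus = "real ^ ('k::finite)" / "\<lambda>x y. \<forall>i. x $ i - y $ i \<in> \<int>"
proof (rule equivpI)
  show "reflp (\<lambda>x y :: real ^ 'k. \<forall>i. x $ i - y $ i \<in> \<int>)"
    by (simp add: reflp_def)
  show "symp (\<lambda>x y :: real ^ 'k. \<forall>i. x $ i - y $ i \<in> \<int>)"
    unfolding symp_def by (metis Ints_minus minus_diff_eq)
  show "transp (\<lambda>x y :: real ^ 'k. \<forall>i. x $ i - y $ i \<in> \<int>)"
  proof (rule transpI, rule allI)
    fix x y z :: "real ^ 'k" and i
    assume "\<forall>i. x $ i - y $ i \<in> \<int>" "\<forall>i. y $ i - z $ i \<in> \<int>"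
    then have "(x $ i - y $ i) + (y $ i - z $ i) \<in> \<int>"
      by (intro Ints_add) auto
    then show "x $ i - z $ i \<in> \<int>"
      by simp
  qed
qed

instantiation torus :: (finite) ab_group_add
begin

lift_definition zero_torus :: "'a torus" is 0 .

lift_definition plus_torus :: "'a torus \<Rightarrow> 'a torus \<Rightarrow> 'a torus" is "(+)"
  unfolding vector_add_component add_diff_add by (blast intro: Ints_add)

lift_definition uminus_torus :: "'a torus \<Rightarrow> 'a torus" is uminus
  unfolding vector_uminus_component minus_diff_minus by (blast intro: Ints_minus)

lift_definition minus_torus :: "'a torus \<Rightarrow> 'a torus \<Rightarrow> 'a torus" is "(-)"
proof -
  fix x x' y y' :: "real ^ 'a" and i
  assume "\<And>i. x $ i - x' $ i \<in> \<int>" "\<And>i. y $ i - y' $ i \<in> \<int>"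
  then have "(x $ i - x' $ i) - (y $ i - y' $ i) \<in> \<int>"
    by (blast intro: Ints_diff)
  also have "(x $ i - x' $ i) - (y $ i - y' $ i) = (x - y) $ i - (x' - y') $ i"
    by simp
  finally show "(x - y) $ i - (x' - y') $ i \<in> \<int>" .
qed

instance
  by standard (transfer; simp add: algebra_simps)+

end

text \<open>The quotient topology.\<close>

instantiation torus :: (finite) topological_space
begin

definition open_torus :: "'a torus set \<Rightarrow> bool" where
  "open_torus U \<longleftrightarrow> open (abs_torus -` U)"

instance
proof
  show "open (UNIV :: 'a torus set)"
    by (simp add: open_torus_def)
  show "open (S \<inter> T)" if "open S" "open T" for S T :: "'a torus set"
    using that by (simp add: open_torus_def open_Int)
  show "open (\<Union>K)" if "\<forall>S\<in>K. open S" for K :: "'a torus set set"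
    using that by (auto simp: open_torus_def vimage_Union)
qed

end

definition delta02 :: "'a::topological_space set \<Rightarrow> bool" where
  "delta02 A \<longleftrightarrow> fsigma A \<and> gdelta A"

section \<open>Actions and Schreier graphs\<close>

definition group_action :: "('g::group_add \<Rightarrow> 'x \<Rightarrow> 'x) \<Rightarrow> bool" where
  "group_action act \<longleftrightarrow>
     (\<forall>p. act 0 p = p) \<and> (\<forall>g h p. act (g + h) p = act g (act h p))"

definition free_action :: "('g::group_add \<Rightarrow> 'x \<Rightarrow> 'x) \<Rightarrow> bool" where
  "free_action act \<longleftrightarrow> group_action act \<and> (\<forall>g p. act g p = p \<longrightarrow> g = 0)"

text \<open>Graphs on the vertex set \<open>UNIV :: 'x set\<close> are given by their edge relations; the relation
  below is symmetric because generating sets are taken to be symmetric.\<close>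

definition schreier_graph :: "('g \<Rightarrow> 'x \<Rightarrow> 'x) \<Rightarrow> 'g set \<Rightarrow> 'x rel" where
  "schreier_graph act S = {(p, act g p) | p g. g \<in> S}"

definition sup_sphere :: "(int ^ 'd::finite) set" where
  "sup_sphere = {g. (MAX i. \<bar>g $ i\<bar>) = 1}"

section \<open>Graph distance and toasts\<close>

text \<open>The infimum of an empty set of extended naturals is \<open>\<infinity>\<close>.  So points in different
  components have distance \<open>\<infinity>\<close>, and so do two sets of which one is empty.\<close>

definition gdist :: "'x rel \<Rightarrow> 'x \<Rightarrow> 'x \<Rightarrow> enat" where
  "gdist G x y = (INF n \<in> {n. (x, y) \<in> G ^^ n}. enat n)"

definition set_gdist :: "'x rel \<Rightarrow> 'x set \<Rightarrow> 'x set \<Rightarrow> enat" where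
  "set_gdist G A B = (INF x\<in>A. INF y\<in>B. gdist G x y)"

definition gdiam :: "'x rel \<Rightarrow> 'x set \<Rightarrow> enat" where
  "gdiam G A = (SUP x\<in>A. SUP y\<in>A. gdist G x y)"

definition graph_le :: "'x rel \<Rightarrow> nat \<Rightarrow> 'x rel" where
  "graph_le G q = {(x, y). gdist G x y \<le> enat q}"

text \<open>Connected components of the subgraph of \<open>H\<close> induced on \<open>Y\<close>, for symmetric \<open>H\<close>.\<close>

definition induced_components :: "'x rel \<Rightarrow> 'x set \<Rightarrow> 'x set set" where
  "induced_components H Y = Y // (Restr H Y)\<^sup>*"

definition interior_boundary :: "'x rel \<Rightarrow> 'x set \<Rightarrow> 'x set" where
  "interior_boundary G R = {x \<in> R. set_gdist G {x} (- R) \<le> 1}"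

definition toast :: "'x rel \<Rightarrow> nat \<Rightarrow> (nat \<Rightarrow> 'x set) \<Rightarrow> bool" where
  "toast G q T \<longleftrightarrow>
     (\<Union>n. T n) = UNIV \<and>
     (\<forall>n. \<exists>D::nat. \<forall>C \<in> induced_components (graph_le G q) (T n). gdiam G C \<le> enat D) \<and>
     (\<forall>n m. n < m \<longrightarrow> set_gdist G (T n) (interior_boundary G (T m)) \<ge> enat q)"

end

theory Submission
  imports Defs
begin

text \<open>The group acts by translations, \<open>act g p = p + act g 0\<close>, and \<open>near n x y\<close> says that \<open>y\<close> arises
  from \<open>x\<close> by a group element of sup norm at most \<open>n\<close>, equivalently that the two points have graph
  distance at most \<open>n\<close>.  Call a set bounded at scale \<open>r\<close> if the points that can be joined inside it by
  jumps of length \<open>r\<close> are uniformly close.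

  First, the action has finite asymptotic dimension in an open form (\<open>open_cover\<close>): there is a number
  \<open>s\<close> such that for every \<open>R\<close> the torus has a cover by \<open>s\<close> open sets (colours), each bounded at scale
  \<open>R\<close>.  One takes a maximal set of centres that are separated in the combined sense of group
  elements of norm \<open>R\<close> and translations by less than \<open>\<epsilon>\<close>, and surrounds them by neighbourhoods of the
  same kind.  A packing argument bounds the number of neighbours of a centre independently of \<open>R\<close> and
  \<open>\<epsilon>\<close>, so that a greedy colouring needs boundedly many colours; freeness allows \<open>\<epsilon>\<close> so small that a
  neighbourhood meets an orbit in clusters that do not run into each other.

  Secondly, let \<open>U n 0, U n 1, \<dots>\<close> be such covers along a rapidly growing sequence of scales.  One layer
  per scale is wanted, bounded at a scale \<open>\<rho> n\<close> that exceeds the size of all earlier layers, and the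
  layers together have to cover.  Two colours of the same scale cannot both be used in
  full, and a fixed choice of one colour at each scale may miss points.  So let the
  colour vary with the point: let \<open>A n x\<close> be the largest \<open>a\<close> such that \<open>x\<close> is near \<open>U j a\<close> for some
  \<open>j \<ge> n\<close>.  Admit \<open>x\<close> to layer \<open>n\<close> with colour \<open>a = A n x\<close>, if it is near \<open>U n a\<close> and if
  \<open>a\<close> is attained with a margin \<open>\<rho> n\<close>, which forces points that are \<open>\<rho> n\<close>-near to have colour at least
  \<open>a\<close>.  By symmetry, different colours of one layer are far apart, hence the layer is bounded
  (\<open>pieces_bounded\<close>).  Since \<open>A n x\<close> decreases with \<open>n\<close> and has finitely many values, it is eventually
  constant, with a margin, and then \<open>x\<close> is admitted at any \<open>j\<close> at which the value is attained
  (\<open>pieces_cover\<close>).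

  Finally, layer \<open>m\<close> swallows everything that it can reach through the earlier layers
  (\<open>toast_layer\<close>).  As the layers are bounded at rapidly growing scales, this enlarges it by a bounded
  amount only (\<open>links_absorbed_bound\<close>).

  The complexity is low because the conditions \<open>A n x \<ge> a\<close> define unions of open sets, hence open
  sets, even though they involve infinitely many scales.  So the selected pieces are finite Boolean
  combinations of open sets, and swallowing is a local operation, which keeps them in the algebra of
  sets that are both \<open>F\<^sub>\<sigma>\<close> and \<open>G\<^sub>\<delta>\<close>.\<close>

section \<open>Coarse spaces\<close>

text \<open>The metric part of the argument needs an orbit metric only through its relations
  "at distance at most \<open>n\<close>"; points of different orbits are not related for any \<open>n\<close>.\<close>

locale coarse_space =
  fixes near :: "nat \<Rightarrow> 'x \<Rightarrow> 'x \<Rightarrow> bool"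
  assumes near_refl [simp, intro]: "near n x x"
    and near_sym: "near n x y \<Longrightarrow> near n y x"
    and near_trans: "near m x y \<Longrightarrow> near n y z \<Longrightarrow> near (m + n) x z"
begin

lemma near_mono: "near m x y \<Longrightarrow> m \<le> n \<Longrightarrow> near n x y"
  using near_trans[of m x y "n - m" y] by simp

definition thick :: "nat \<Rightarrow> 'x set \<Rightarrow> 'x set" where
  "thick n A = {x. \<exists>y\<in>A. near n x y}"

definition steps :: "nat \<Rightarrow> 'x set \<Rightarrow> 'x rel" where
  "steps r A = {(x, y). x \<in> A \<and> y \<in> A \<and> near r x y}"

definition bounded_at :: "nat \<Rightarrow> nat \<Rightarrow> 'x set \<Rightarrow> bool" where
  "bounded_at r D A \<longleftrightarrow> (\<forall>x y. (x, y) \<in> (steps r A)\<^sup>* \<longrightarrow> near D x y)"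

lemma thick_mono: "m \<le> n \<Longrightarrow> thick m A \<subseteq> thick n A"
  unfolding thick_def using near_mono by blast

lemma thick_thick: "near m x y \<Longrightarrow> y \<in> thick n A \<Longrightarrow> x \<in> thick (m + n) A"
  unfolding thick_def using near_trans by blast

section \<open>Selecting pieces from coloured covers\<close>

text \<open>\<open>future U \<rho> n a\<close> is where colour \<open>a\<close> is still to come: the points near \<open>U j a\<close> for some
  \<open>j \<ge> n\<close>.  How near depends on both indices: as \<open>n\<close> grows to \<open>Suc n\<close> with \<open>j\<close> fixed, the
  neighbourhood of \<open>U j a\<close> loses a margin of width \<open>\<rho> n\<close>.  Only finitely many margins are spent on
  a given \<open>j\<close>, which is why the neighbourhoods can shrink for ever without disappearing.\<close>

definition future :: "(nat \<Rightarrow> nat \<Rightarrow> 'x set) \<Rightarrow> (nat \<Rightarrow> nat) \<Rightarrow> nat \<Rightarrow> nat \<Rightarrow> 'x set" where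
  "future U \<rho> n a = (\<Union>j\<in>{n..}. thick (\<Sum>i\<in>{n..j}. \<rho> i) (U j a))"

text \<open>The points at which colour \<open>a\<close> is still to come with a margin of \<open>\<rho> n\<close>.  The index \<open>j = n\<close>
  contributes \<open>U n a\<close> itself, the sum being empty.\<close>

definition deep_future :: "(nat \<Rightarrow> nat \<Rightarrow> 'x set) \<Rightarrow> (nat \<Rightarrow> nat) \<Rightarrow> nat \<Rightarrow> nat \<Rightarrow> 'x set" where
  "deep_future U \<rho> n a = (\<Union>j\<in>{n..}. thick (\<Sum>i\<in>{Suc n..j}. \<rho> i) (U j a))"

text \<open>The points of layer \<open>n\<close> with colour \<open>a\<close>: the largest colour that is still to come is \<open>a\<close>, it
  is so with a margin, and it shows at scale \<open>n\<close>.\<close>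

definition piece where
  "piece U \<rho> s n a =
     deep_future U \<rho> n a \<inter> thick (\<Sum>i\<le>n. \<rho> i) (U n a) - (\<Union>b\<in>{a<..<s}. future U \<rho> n b)"

definition pieces where
  "pieces U \<rho> s n = (\<Union>a<s. piece U \<rho> s n a)"

lemma future_Suc_subset: "future U \<rho> (Suc n) a \<subseteq> deep_future U \<rho> n a"
  unfolding future_def deep_future_def
  by (rule UN_mono) auto

lemma deep_future_near:
  assumes "near (\<rho> n) x y" "y \<in> deep_future U \<rho> n a"
  shows "x \<in> future U \<rho> n a"
proof -
  obtain j where j: "j \<ge> n" "y \<in> thick (\<Sum>i\<in>{Suc n..j}. \<rho> i) (U j a)"
    using assms(2) by (auto simp: deep_future_def)
  have "x \<in> thick (\<rho> n + (\<Sum>i\<in>{Suc n..j}. \<rho> i)) (U j a)"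
    using thick_thick assms(1) j(2) by blast
  also have "\<rho> n + (\<Sum>i\<in>{Suc n..j}. \<rho> i) = (\<Sum>i\<in>{n..j}. \<rho> i)"
    using j(1) by (simp add: sum.atLeast_Suc_atMost)
  finally show ?thesis
    using j(1) by (auto simp: future_def)
qed

lemma future_antimono: "m \<le> n \<Longrightarrow> future U \<rho> n a \<subseteq> future U \<rho> m a"
proof (induction rule: dec_induct)
  case (step n)
  have "deep_future U \<rho> n a \<subseteq> future U \<rho> n a"
    using deep_future_near near_refl by blast
  then show ?case
    using step future_Suc_subset by blast
qed simp

text \<open>The sets \<open>future U \<rho> n a\<close> decrease in \<open>n\<close>, so for a point \<open>x\<close> some largest colour \<open>a\<close> stays in the
  future for ever, and from some index \<open>M\<close> on no larger colour does.  Any \<open>j \<ge> M\<close> that witnesses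
  that \<open>a\<close> is in the future at \<open>M\<close> admits \<open>x\<close> to layer \<open>j\<close>; the margin comes for free,
  since \<open>a\<close> is still in the future at \<open>Suc j\<close>.  It is essential that the number of colours does not grow
  with the scale.\<close>

lemma pieces_cover:
  assumes cover: "\<And>n x. \<exists>a<s. x \<in> U n a"
  shows "(\<Union>n. pieces U \<rho> s n) = UNIV"
proof -
  have "\<exists>n. x \<in> pieces U \<rho> s n" for x
  proof -
    let ?A = "{a. a < s \<and> (\<forall>n. x \<in> future U \<rho> n a)}"
    have "?A \<noteq> {}"
    proof
      assume "?A = {}"
      then obtain N where N: "\<And>a. a < s \<Longrightarrow> x \<notin> future U \<rho> (N a) a"
        by (auto intro: that) metis
      \<comment> \<open>A sum serves as a common upper bound of the finitely many indices.\<close>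
      define M where "M = (\<Sum>a<s. N a)"
      obtain a where a: "a < s" "x \<in> U M a"
        using cover by blast
      have "x \<in> future U \<rho> M a"
        using a(2) by (auto simp: future_def thick_def intro!: bexI[of _ M])
      moreover have "N a \<le> M"
        unfolding M_def using a(1) by (intro member_le_sum) auto
      ultimately show False
        using N[OF a(1)] future_antimono by blast
    qed
    moreover have fin: "finite ?A"
      by simp
    ultimately have max: "Max ?A \<in> ?A" "\<And>b. b \<in> ?A \<Longrightarrow> b \<le> Max ?A"
      using Max_in Max_ge by blast+
    define a where "a = Max ?A"
    have a: "a < s" "\<And>n. x \<in> future U \<rho> n a"
      using max(1) unfolding a_def by blast+
    have "\<forall>b\<in>{a<..<s}. \<exists>n. x \<notin> future U \<rho> n b"
      using max(2) unfolding a_def by fastforce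
    then obtain N where N: "\<And>b. b \<in> {a<..<s} \<Longrightarrow> x \<notin> future U \<rho> (N b) b"
      by metis
    define M where "M = (\<Sum>b\<in>{a<..<s}. N b)"
    have M: "x \<notin> future U \<rho> j b" if "b \<in> {a<..<s}" "M \<le> j" for b j
    proof -
      have "N b \<le> M"
        unfolding M_def using that by (intro member_le_sum) auto
      then show ?thesis
        using N[OF that(1)] that(2) future_antimono[of "N b" j] by fastforce
    qed
    obtain j where j: "j \<ge> M" "x \<in> thick (\<Sum>i\<in>{M..j}. \<rho> i) (U j a)"
      using a(2)[of M] by (auto simp: future_def)
    have "(\<Sum>i\<in>{M..j}. \<rho> i) \<le> (\<Sum>i\<le>j. \<rho> i)"
      by (rule sum_mono2) auto
    then have "x \<in> thick (\<Sum>i\<le>j. \<rho> i) (U j a)"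
      using j(2) thick_mono by blast
    moreover have "x \<in> deep_future U \<rho> j a"
      using a(2) future_Suc_subset by blast
    ultimately have "x \<in> piece U \<rho> s j a"
      using M j(1) by (auto simp: piece_def)
    then show ?thesis
      using a(1) by (auto simp: pieces_def)
  qed
  then show ?thesis
    by blast
qed

text \<open>If two points of a layer are \<open>\<rho> n\<close>-near, the margin of the point with the larger colour puts
  that colour into the future of the other one, so that the colours agree.  Hence a chain of
  \<open>\<rho> n\<close>-jumps stays in one colour and shadows a chain in \<open>U n a\<close>.\<close>

lemma pieces_bounded:
  assumes bounded: "\<And>a. a < s \<Longrightarrow> bounded_at (2 * (\<Sum>i\<le>n. \<rho> i) + \<rho> n) D (U n a)"
  shows "bounded_at (\<rho> n) (2 * (\<Sum>i\<le>n. \<rho> i) + D) (pieces U \<rho> s n)"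
proof -
  define \<sigma> where "\<sigma> = (\<Sum>i\<le>n. \<rho> i)"
  have same: "b \<le> a"
    if "x \<in> piece U \<rho> s n a" "y \<in> piece U \<rho> s n b" "near (\<rho> n) x y" "b < s" for x y a b
  proof (rule ccontr)
    assume "\<not> b \<le> a"
    then have "x \<notin> future U \<rho> n b"
      using that by (auto simp: piece_def)
    then show False
      using that deep_future_near by (auto simp: piece_def)
  qed
  have path: "\<exists>a<s. \<exists>x'\<in>U n a. \<exists>y'\<in>U n a. near \<sigma> x x' \<and> near \<sigma> y y' \<and>
      (x', y') \<in> (steps (2 * \<sigma> + \<rho> n) (U n a))\<^sup>* \<and> y \<in> piece U \<rho> s n a"
    if "(x, y) \<in> (steps (\<rho> n) (pieces U \<rho> s n))\<^sup>*" "x \<in> pieces U \<rho> s n" for x y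
    using that(1)
  proof induction
    case base
    then show ?case
      using that(2) by (auto simp: pieces_def piece_def thick_def \<sigma>_def)
  next
    case (step y z)
    then obtain a x' y' where a: "a < s" "x' \<in> U n a" "y' \<in> U n a" "near \<sigma> x x'" "near \<sigma> y y'"
      "(x', y') \<in> (steps (2 * \<sigma> + \<rho> n) (U n a))\<^sup>*" "y \<in> piece U \<rho> s n a"
      by blast
    obtain b where b: "b < s" "z \<in> piece U \<rho> s n b" and yz: "near (\<rho> n) y z"
      using step(2) by (auto simp: steps_def pieces_def)
    have ab: "a = b"
      using same[OF a(7) b(2) yz b(1)] same[OF b(2) a(7) near_sym[OF yz] a(1)] by simp
    obtain z' where z': "z' \<in> U n a" "near \<sigma> z z'"
      using b(2) ab by (auto simp: piece_def thick_def \<sigma>_def)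
    have "near (\<sigma> + (\<rho> n + \<sigma>)) y' z'"
      by (intro near_trans[OF near_sym[OF a(5)]] near_trans[OF yz] z'(2))
    then have "(y', z') \<in> steps (2 * \<sigma> + \<rho> n) (U n a)"
      using a(3) z'(1) by (simp add: steps_def add_ac mult_2)
    then show ?case
      using a z' b(2) ab by (meson rtrancl.rtrancl_into_rtrancl)
  qed
  show ?thesis
    unfolding bounded_at_def
  proof (intro allI impI)
    fix x y
    assume xy: "(x, y) \<in> (steps (\<rho> n) (pieces U \<rho> s n))\<^sup>*"
    show "near (2 * (\<Sum>i\<le>n. \<rho> i) + D) x y"
    proof (cases "x \<in> pieces U \<rho> s n")
      case True
      obtain a x' y' where a: "a < s" "near \<sigma> x x'" "near \<sigma> y y'"
        "(x', y') \<in> (steps (2 * \<sigma> + \<rho> n) (U n a))\<^sup>*"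
        using path[OF xy True] by blast
      have "near D x' y'"
        using bounded[OF a(1)] a(4) by (auto simp: bounded_at_def \<sigma>_def)
      then have "near (\<sigma> + (D + \<sigma>)) x y"
        by (intro near_trans[OF a(2)] near_trans[OF _ near_sym[OF a(3)]])
      then show ?thesis
        by (simp add: \<sigma>_def add_ac mult_2)
    next
      case False
      then have "x = y"
        using xy by (auto elim: converse_rtranclE simp: steps_def)
      then show ?thesis
        by simp
    qed
  qed
qed

section \<open>Absorbing earlier pieces\<close>

text \<open>Two points are linked if a ball of radius \<open>q\<close> around some point of \<open>W\<close> contains both.  A set
  that is closed under links contains every such ball or is disjoint from it, which is what a
  layer of a \<open>q\<close>-toast has to satisfy with respect to the earlier ones.\<close>

definition links :: "nat \<Rightarrow> 'x set \<Rightarrow> 'x rel" where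
  "links q W = {(u, v). \<exists>z\<in>W. near q u z \<and> near q z v}"

lemma sym_links: "sym (links q W)"
  unfolding links_def by (rule symI) (auto dest: near_sym)

definition absorb :: "nat \<Rightarrow> 'x set \<Rightarrow> 'x set \<Rightarrow> 'x set" where
  "absorb q W S = (links q W)\<^sup>* `` S"

primrec absorbed :: "nat \<Rightarrow> (nat \<Rightarrow> 'x set) \<Rightarrow> nat \<Rightarrow> 'x set" where
  "absorbed q S 0 = {}"
| "absorbed q S (Suc m) = absorbed q S m \<union> absorb q (absorbed q S m) (S m)"

definition layer :: "nat \<Rightarrow> (nat \<Rightarrow> 'x set) \<Rightarrow> nat \<Rightarrow> 'x set" where
  "layer q S m = absorb q (absorbed q S m) (S m)"

lemma layer_subset_absorbed: "n < m \<Longrightarrow> layer q S n \<subseteq> absorbed q S m"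
proof (induction m)
  case (Suc m)
  then show ?case
    by (cases "n = m") (auto simp: layer_def)
qed simp

text \<open>A chain of links through \<open>W\<close> and the enlarged set \<open>absorb q W S\<close> alternates between chains
  through \<open>W\<close>, of length at most \<open>E\<close>, and visits to points that are \<open>E\<close>-near to \<open>S\<close>.  Consecutive
  visits are so close that the nearby points of \<open>S\<close> are within \<open>3 * E + 2 * q\<close> of each other, and
  so all of them lie in one component of \<open>S\<close> at that scale.\<close>

lemma links_bound_step:
  assumes E: "\<And>u v. (u, v) \<in> (links q W)\<^sup>* \<Longrightarrow> near E u v"
    and S: "bounded_at (3 * E + 2 * q) D S"
    and uv: "(u, v) \<in> (links q (W \<union> absorb q W S))\<^sup>*"
  shows "near (D + 4 * E + 2 * q) u v"
proof -
  have "(u, v) \<in> (links q W)\<^sup>* \<or>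
    (\<exists>s s' w. near (2 * E + q) u s \<and> (s, s') \<in> (steps (3 * E + 2 * q) S)\<^sup>* \<and> s' \<in> S \<and>
       near (E + q) s' w \<and> (w, v) \<in> (links q W)\<^sup>*)"
    (is "?near v \<or> ?far v")
    using uv
  proof induction
    case (step y z)
    obtain t where t: "t \<in> W \<union> absorb q W S" "near q y t" "near q t z"
      using step(2) by (auto simp: links_def)
    show ?case
    proof (cases "t \<in> W")
      case True
      then have "(y, z) \<in> links q W"
        using t by (auto simp: links_def)
      then show ?thesis
        using step(3) by (meson rtrancl.rtrancl_into_rtrancl)
    next
      case False
      then obtain s'' where s'': "s'' \<in> S" "(s'', t) \<in> (links q W)\<^sup>*"
        using t(1) by (auto simp: absorb_def)
      have s''t: "near E s'' t"
        using E s''(2) by blast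
      have s''z: "near (E + q) s'' z"
        using near_trans[OF s''t t(3)] .
      have ys'': "near (q + E) y s''"
        using near_trans[OF t(2) near_sym[OF s''t]] .
      from step(3) show ?thesis
      proof
        assume "?near y"
        then have "near (E + (q + E)) u s''"
          using E near_trans ys'' by blast
        then have "near (2 * E + q) u s''"
          by (simp add: add_ac mult_2)
        then have "?far z"
          using s''(1) s''z by blast
        then show ?thesis ..
      next
        assume "?far y"
        then obtain s s' w where w: "near (2 * E + q) u s" "(s, s') \<in> (steps (3 * E + 2 * q) S)\<^sup>*"
          "s' \<in> S" "near (E + q) s' w" "(w, y) \<in> (links q W)\<^sup>*"
          by blast
        have "near (E + q + (E + (q + E))) s' s''"
          by (intro near_trans[OF w(4)] near_trans[OF _ ys'']) (use E w(5) in blast)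
        moreover have "E + q + (E + (q + E)) = 3 * E + 2 * q"
          by simp
        ultimately have "(s', s'') \<in> steps (3 * E + 2 * q) S"
          using w(3) s''(1) by (simp add: steps_def)
        then have "?far z"
          using w(1,2) s''(1) s''z by (meson rtrancl.rtrancl_into_rtrancl rtrancl.rtrancl_refl)
        then show ?thesis ..
      qed
    qed
  qed simp
  then show ?thesis
  proof
    assume "?near v"
    then show ?thesis
      using E near_mono[of E u v "D + 4 * E + 2 * q"] by simp
  next
    assume "?far v"
    then obtain s s' w where w: "near (2 * E + q) u s" "(s, s') \<in> (steps (3 * E + 2 * q) S)\<^sup>*"
      "near (E + q) s' w" "(w, v) \<in> (links q W)\<^sup>*"
      by blast
    have "near (2 * E + q + (D + (E + q + E))) u v"
      by (intro near_trans[OF w(1)] near_trans[OF _ near_trans[OF w(3)]])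
        (use E w(4) S w(2) in \<open>auto simp: bounded_at_def\<close>)
    moreover have "2 * E + q + (D + (E + q + E)) = D + 4 * E + 2 * q"
      by simp
    ultimately show ?thesis
      by metis
  qed
qed

lemma links_absorbed_bound:
  assumes "E 0 = 0"
    and "\<And>m. bounded_at (3 * E m + 2 * q) (D m) (S m)"
    and "\<And>m. E (Suc m) = D m + 4 * E m + 2 * q"
    and "(u, v) \<in> (links q (absorbed q S m))\<^sup>*"
  shows "near (E m) u v"
  using assms(4)
proof (induction m arbitrary: u v)
  case 0
  then show ?case
    by (simp add: links_def)
next
  case (Suc m)
  then show ?case
    using links_bound_step[of q "absorbed q S m" "E m" "D m" "S m" u v] assms(2,3) by simp
qed

text \<open>If a point of an earlier layer were at distance less than \<open>q\<close> from the interior boundary of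
  layer \<open>m\<close>, then its \<open>q\<close>-ball would contain points inside and outside of layer \<open>m\<close>, which are
  linked.  Moreover \<open>q\<close>-steps inside layer \<open>n\<close> are links through the layers up to \<open>n\<close>, so a bound for
  chains of links bounds the components.\<close>

lemma toast_layer:
  assumes G: "\<And>n x y. gdist G x y \<le> enat n \<longleftrightarrow> near n x y"
    and cover: "(\<Union>m. S m) = UNIV"
    and E: "\<And>m u v. (u, v) \<in> (links q (absorbed q S m))\<^sup>* \<Longrightarrow> near (E m) u v"
  shows "toast G q (layer q S)"
proof -
  have union: "(\<Union>m. layer q S m) = UNIV"
    using cover unfolding layer_def absorb_def by blast
  have comps: "gdiam G C \<le> enat (E (Suc n))"
    if C: "C \<in> induced_components (graph_le G q) (layer q S n)" for n C
  proof -
    let ?R = "Restr (graph_le G q) (layer q S n)"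
    have "?R \<subseteq> links q (absorbed q S (Suc n))"
      using layer_subset_absorbed[of n "Suc n" q S] G
      by (fastforce simp: graph_le_def links_def)
    then have sub: "?R\<^sup>* \<subseteq> (links q (absorbed q S (Suc n)))\<^sup>*"
      by (rule rtrancl_mono)
    have sym: "sym ((links q (absorbed q S (Suc n)))\<^sup>*)"
      by (intro sym_rtrancl sym_links)
    obtain c where c: "C = ?R\<^sup>* `` {c}"
      using C unfolding induced_components_def by (auto elim: quotientE)
    have "gdist G x y \<le> enat (E (Suc n))" if "x \<in> C" "y \<in> C" for x y
    proof -
      have "(x, y) \<in> (links q (absorbed q S (Suc n)))\<^sup>*"
        using that c sub sym by (meson Image_singleton_iff rtrancl_trans subsetD symD)
      then show ?thesis
        using E G by blast
    qed
    then show ?thesis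
      unfolding gdiam_def by (intro SUP_least) auto
  qed
  have boundary: "enat q \<le> set_gdist G (layer q S n) (interior_boundary G (layer q S m))"
    if "n < m" for n m
    unfolding set_gdist_def
  proof (intro INF_greatest)
    fix x y
    assume x: "x \<in> layer q S n" and y: "y \<in> interior_boundary G (layer q S m)"
    show "enat q \<le> gdist G x y"
    proof (rule ccontr)
      assume "\<not> enat q \<le> gdist G x y"
      then obtain d where d: "gdist G x y = enat d" "d < q"
        by (metis enat_ord_simps(2) not_le enat_iless)
      have xy: "near d x y"
        using G[of x y d] d(1) by simp
      have ym: "y \<in> layer q S m" and "set_gdist G {y} (- layer q S m) \<le> 1"
        using y by (auto simp: interior_boundary_def)
      then have "(INF w\<in>- layer q S m. gdist G y w) < eSuc 1"
        by (auto simp: set_gdist_def eSuc_enat one_enat_def intro: le_less_trans)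
      then obtain w where w: "w \<notin> layer q S m" "gdist G y w < eSuc 1"
        by (auto simp: INF_less_iff)
      then have yw: "near 1 y w"
        using G[of y w 1] by (cases "gdist G y w") (auto simp: eSuc_enat one_enat_def)
      have "near (d + 1) x w"
        using near_trans[OF xy yw] .
      then have "near q x w"
        using d(2) near_mono by simp
      moreover have "near q y x"
        using near_mono[OF near_sym[OF xy]] d(2) by simp
      moreover have "x \<in> absorbed q S m"
        using x layer_subset_absorbed[OF that] by blast
      ultimately have "(y, w) \<in> links q (absorbed q S m)"
        by (auto simp: links_def)
      then have "w \<in> layer q S m"
        using ym unfolding layer_def absorb_def by (blast intro: rtrancl_into_rtrancl)
      then show False
        using w(1) by simp
    qed
  qed
  show ?thesis
    unfolding toast_def using union comps boundary by blast
qed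

end

section \<open>The algebra of ambiguous sets\<close>

lemma fsigma_in_closed_UN: "(\<And>n::nat. closed (F n)) \<Longrightarrow> fsigma_in euclidean (\<Union>n. F n)"
  by (intro fsigma_in_Union) (auto intro: closed_imp_fsigma_in)

lemma delta02_iff: "delta02 A \<longleftrightarrow> fsigma_in euclidean A \<and> fsigma_in euclidean (- A)"
proof -
  have eq: "fsigma B \<longleftrightarrow> fsigma_in euclidean B" for B :: "'a set"
  proof
    assume "fsigma B"
    then obtain F :: "nat \<Rightarrow> 'a set" where "\<And>n. closed (F n)" "B = \<Union>(range F)"
      by (auto elim: fsigma.cases)
    then show "fsigma_in euclidean B"
      by (simp add: fsigma_in_closed_UN)
  next
    assume "fsigma_in euclidean B"
    then show "fsigma B"
      using fsigma.intros by (auto simp: fsigma_in_ascending)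
  qed
  show ?thesis
    unfolding delta02_def by (metis eq gdelta_complement double_complement)
qed

lemma delta02_Compl: "delta02 A \<Longrightarrow> delta02 (- A)"
  by (simp add: delta02_iff)

lemma delta02_Un: "delta02 A \<Longrightarrow> delta02 B \<Longrightarrow> delta02 (A \<union> B)"
  by (simp add: delta02_iff fsigma_in_Un fsigma_in_Int)

lemma delta02_Int: "delta02 A \<Longrightarrow> delta02 B \<Longrightarrow> delta02 (A \<inter> B)"
  by (simp add: delta02_iff fsigma_in_Un fsigma_in_Int)

lemma delta02_Diff: "delta02 A \<Longrightarrow> delta02 B \<Longrightarrow> delta02 (A - B)"
  by (simp add: Diff_eq delta02_Int delta02_Compl)

lemma delta02_empty [simp]: "delta02 {}"
  using fsigma_in_topspace[of euclidean] by (simp add: delta02_iff)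

lemma delta02_UNIV [simp]: "delta02 UNIV"
  using delta02_Compl[OF delta02_empty] by simp

lemma delta02_UN: "finite I \<Longrightarrow> (\<And>i. i \<in> I \<Longrightarrow> delta02 (A i)) \<Longrightarrow> delta02 (\<Union>i\<in>I. A i)"
  by (induction I rule: finite_induct) (auto intro: delta02_Un)

text \<open>A set is ambiguous if membership in it depends only on membership in finitely many ambiguous sets.
  This replaces explicit Boolean formulas for sets that are defined by finite local patterns.\<close>

lemma delta02_determined:
  assumes "finite I" "\<And>i. i \<in> I \<Longrightarrow> delta02 (B i)"
    and "\<And>x y. (\<And>i. i \<in> I \<Longrightarrow> x \<in> B i \<longleftrightarrow> y \<in> B i) \<Longrightarrow> x \<in> A \<Longrightarrow> y \<in> A"
  shows "delta02 A"
  using assms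
proof (induction I arbitrary: A rule: finite_induct)
  case empty
  then have "A = {} \<or> A = UNIV"
    by blast
  then show ?case
    by auto
next
  case (insert k I)
  define A1 where "A1 = {y. \<exists>x\<in>A \<inter> B k. \<forall>i\<in>I. x \<in> B i \<longleftrightarrow> y \<in> B i}"
  define A0 where "A0 = {y. \<exists>x\<in>A - B k. \<forall>i\<in>I. x \<in> B i \<longleftrightarrow> y \<in> B i}"
  have "delta02 A1" "delta02 A0"
    unfolding A1_def A0_def by (rule insert.IH; use insert.prems in blast)+
  moreover have "delta02 (B k)"
    using insert.prems by simp
  moreover have "A = (A1 \<inter> B k) \<union> (A0 - B k)"
  proof (intro equalityI subsetI)
    fix y
    assume "y \<in> (A1 \<inter> B k) \<union> (A0 - B k)"
    then obtain x where "x \<in> A" "\<forall>i\<in>insert k I. x \<in> B i \<longleftrightarrow> y \<in> B i"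
      by (auto simp: A1_def A0_def)
    then show "y \<in> A"
      using insert.prems(2)[of x y] by blast
  qed (auto simp: A1_def A0_def)
  ultimately show ?case
    by (metis delta02_Un delta02_Int delta02_Diff)
qed

section \<open>Small elements and the topology of the torus\<close>

lemma abs_torus_surj: "\<exists>v. t = abs_torus v"
  using Quotient3_abs_rep[OF Quotient3_torus, of t] by metis

lemma abs_torus_eq_iff: "abs_torus u = abs_torus v \<longleftrightarrow> (\<forall>i. u $ i - v $ i \<in> \<int>)"
  by (rule torus.abs_eq_iff)

lemma abs_torus_add: "abs_torus u + abs_torus v = abs_torus (u + v)"
  by (rule plus_torus.abs_eq)

lemma abs_torus_diff: "abs_torus u - abs_torus v = abs_torus (u - v)"
  by (rule minus_torus.abs_eq)

lemma abs_torus_minus: "- abs_torus v = abs_torus (- v)"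
  by (rule uminus_torus.abs_eq)

lemma abs_torus_0: "abs_torus 0 = 0"
  by (simp add: zero_torus_def)

text \<open>These sets are the open cubes around the origin; they take the place of a metric on the torus.\<close>

definition small :: "real \<Rightarrow> 'k::finite torus \<Rightarrow> bool" where
  "small e t \<longleftrightarrow> (\<exists>v. t = abs_torus v \<and> (\<forall>i. \<bar>v $ i\<bar> < e))"

lemma small_0: "0 < e \<Longrightarrow> small e 0"
  unfolding small_def using abs_torus_0 by (intro exI[of _ 0]) auto

lemma small_minus: "small e t \<Longrightarrow> small e (- t)"
  unfolding small_def
proof (elim exE conjE)
  fix v
  assume "t = abs_torus v" "\<forall>i. \<bar>v $ i\<bar> < e"
  then show "\<exists>v. - t = abs_torus v \<and> (\<forall>i. \<bar>v $ i\<bar> < e)"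
    by (intro exI[of _ "- v"]) (simp add: abs_torus_minus)
qed

lemma small_add:
  assumes "small e s" "small f t"
  shows "small (e + f) (s + t)"
proof -
  obtain v w where "s = abs_torus v" "\<forall>i. \<bar>v $ i\<bar> < e" "t = abs_torus w" "\<forall>i. \<bar>w $ i\<bar> < f"
    using assms by (auto simp: small_def)
  moreover from this have "\<bar>v $ i + w $ i\<bar> < e + f" for i
    using abs_triangle_ineq[of "v $ i" "w $ i"] by (smt (verit))
  ultimately show ?thesis
    unfolding small_def by (intro exI[of _ "v + w"]) (simp add: abs_torus_add)
qed

lemma small_mono: "small e t \<Longrightarrow> e \<le> f \<Longrightarrow> small f t"
  unfolding small_def by (blast intro: order.strict_trans2)

lemma not_small:
  assumes "t \<noteq> 0"
  shows "\<exists>e>0. \<not> small e t"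
proof -
  obtain u where u: "t = abs_torus u"
    using abs_torus_surj by blast
  then obtain i where i: "u $ i \<notin> \<int>"
    using assms abs_torus_eq_iff[of u 0] abs_torus_0 by auto
  have "open (- \<int> :: real set)"
    by (intro open_Compl closed_Ints)
  then obtain e where e: "e > 0" "ball (u $ i) e \<subseteq> - \<int>"
    using i open_contains_ball by blast
  have "\<not> small e t"
  proof
    assume "small e t"
    then obtain v where v: "abs_torus u = abs_torus v" "\<bar>v $ i\<bar> < e"
      using u by (auto simp: small_def)
    then have "u $ i - v $ i \<in> \<int>" "u $ i - v $ i \<in> ball (u $ i) e"
      by (auto simp: abs_torus_eq_iff dist_real_def)
    then show False
      using e(2) by blast
  qed
  then show ?thesis
    using e(1) by blast
qed

lemma not_small_uniform:
  assumes "finite F" "0 \<notin> F"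
  shows "\<exists>e>0. \<forall>t\<in>F. \<not> small e t"
  using assms
proof (induction rule: finite_induct)
  case empty
  then show ?case
    using zero_less_one by blast
next
  case (insert t F)
  then obtain e f where "e > 0" "\<forall>t\<in>F. \<not> small e t" "f > 0" "\<not> small f t"
    using not_small[of t] by auto
  then show ?case
    using small_mono[of "min e f" _ e] small_mono[of "min e f" _ f]
    by (intro exI[of _ "min e f"]) auto
qed

text \<open>The points whose coordinates are multiples of \<open>1 / N\<close>.\<close>

lemma finite_net:
  assumes "0 < e"
  shows "\<exists>P :: 'k::finite torus set. finite P \<and> (\<forall>t. \<exists>p\<in>P. small e (t - p))"
proof -
  obtain N :: nat where N: "N > 0" "1 / real N < e"
    using assms by (metis nat_approx_posE zero_less_Suc)
  define F where "F = (UNIV :: 'k set) \<rightarrow>\<^sub>E {..<N}"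
  define p :: "('k \<Rightarrow> nat) \<Rightarrow> 'k torus" where "p f = abs_torus (\<chi> i. real (f i) / real N)" for f
  have "\<exists>f\<in>F. small e (t - p f)" for t
  proof -
    obtain u where u: "t = abs_torus u"
      using abs_torus_surj by blast
    define f where "f i = nat \<lfloor>real N * frac (u $ i)\<rfloor>" for i
    have f: "real (f i) \<le> real N * frac (u $ i)" "real N * frac (u $ i) < real (f i) + 1" for i
      unfolding f_def using N(1) by (auto simp: frac_ge_0)
    have "f i < N" for i
    proof -
      have "real N * frac (u $ i) < real N * 1"
        using N(1) frac_lt_1 by (intro mult_strict_left_mono) auto
      then show ?thesis
        using f(1)[of i] by simp
    qed
    then have "f \<in> F"
      by (auto simp: F_def)
    moreover have "t - p f = abs_torus (\<chi> i. frac (u $ i) - real (f i) / real N)"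
      unfolding u p_def abs_torus_diff by (auto simp: abs_torus_eq_iff frac_def)
    moreover have "\<bar>frac (u $ i) - real (f i) / real N\<bar> < e" for i
    proof -
      have "real (f i) / real N \<le> frac (u $ i)"
        using f(1)[of i] N(1) by (simp add: pos_divide_le_eq mult.commute)
      moreover have "frac (u $ i) < (real (f i) + 1) / real N"
        using f(2)[of i] N(1) by (simp add: pos_less_divide_eq mult.commute)
      ultimately show ?thesis
        using N(2) by (simp add: add_divide_distrib)
    qed
    ultimately show ?thesis
      unfolding small_def by (intro bexI[of _ f]) auto
  qed
  moreover have "finite (p ` F)"
    unfolding F_def by (intro finite_imageI finite_PiE) auto
  ultimately show ?thesis
    by (intro exI[of _ "p ` F"]) auto
qed

text \<open>The preimage in Euclidean space is the union of the integer translates of an open cube.\<close>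

lemma open_small: "open {t :: 'k::finite torus. small e (t - c)}"
proof -
  obtain w where w: "c = abs_torus w"
    using abs_torus_surj by blast
  define B where "B z = {u :: real ^ 'k. \<forall>i. \<bar>u $ i - w $ i - z $ i\<bar> < e}" for z
  have "open (B z)" for z
  proof -
    have "B z = (\<Inter>i. {u. \<bar>u $ i - w $ i - z $ i\<bar> < e})"
      by (auto simp: B_def)
    also have "open \<dots>"
      by (intro open_INT ballI open_Collect_less continuous_intros) auto
    finally show ?thesis .
  qed
  moreover have "abs_torus -` {t. small e (t - c)} = (\<Union>z\<in>{z. \<forall>i. z $ i \<in> \<int>}. B z)"
  proof (intro equalityI subsetI)
    fix u
    assume "u \<in> abs_torus -` {t. small e (t - c)}"
    then obtain v where v: "abs_torus (u - w) = abs_torus v" "\<forall>i. \<bar>v $ i\<bar> < e"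
      by (auto simp: small_def w abs_torus_diff)
    then have "u \<in> B (u - w - v)" "\<forall>i. (u - w - v) $ i \<in> \<int>"
      by (auto simp: B_def abs_torus_eq_iff)
    then show "u \<in> (\<Union>z\<in>{z. \<forall>i. z $ i \<in> \<int>}. B z)"
      by blast
  next
    fix u
    assume "u \<in> (\<Union>z\<in>{z. \<forall>i. z $ i \<in> \<int>}. B z)"
    then obtain z where z: "\<forall>i. z $ i \<in> \<int>" "u \<in> B z"
      by blast
    have "abs_torus u - c = abs_torus (u - w - z)"
      using z(1) by (simp add: w abs_torus_diff abs_torus_eq_iff)
    then show "u \<in> abs_torus -` {t. small e (t - c)}"
      using z(2) by (auto simp: small_def B_def)
  qed
  ultimately show ?thesis
    unfolding open_torus_def by auto
qed

lemma open_translate: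
  assumes "open U"
  shows "open {x :: 'k::finite torus. x + t \<in> U}"
proof -
  obtain w where w: "t = abs_torus w"
    using abs_torus_surj by blast
  have "abs_torus -` {x. x + t \<in> U} = (\<lambda>u. u + w) -` (abs_torus -` U)"
    by (auto simp: w abs_torus_add)
  moreover have "open ((\<lambda>u. u + w) -` V)" if "open V" for V
    using that by (intro open_vimage continuous_intros)
  ultimately show ?thesis
    using assms by (simp add: open_torus_def)
qed

lemma open_contains_small:
  assumes "open U" "x \<in> U"
  shows "\<exists>n. \<forall>t. small (1 / real (Suc n)) t \<longrightarrow> x + t \<in> (U :: 'k::finite torus set)"
proof -
  obtain u where u: "x = abs_torus u"
    using abs_torus_surj by blast
  have "open (abs_torus -` U)" "u \<in> abs_torus -` U"
    using assms u by (auto simp: open_torus_def)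
  then obtain e where e: "e > 0" "ball u e \<subseteq> abs_torus -` U"
    using open_contains_ball by blast
  obtain n where n: "1 / real (Suc n) < e / real CARD('k)"
    using e(1) by (metis nat_approx_posE divide_pos_pos of_nat_0_less_iff zero_less_card_finite)
  have "x + t \<in> U" if t: "small (1 / real (Suc n)) t" for t
  proof -
    obtain v where v: "t = abs_torus v" "\<And>i. \<bar>v $ i\<bar> < 1 / real (Suc n)"
      using t by (auto simp: small_def)
    have "norm v \<le> (\<Sum>i\<in>UNIV. \<bar>v $ i\<bar>)"
      by (rule norm_le_l1_cart)
    also have "\<dots> < (\<Sum>i\<in>(UNIV :: 'k set). e / real CARD('k))"
      by (intro sum_strict_mono) (use v(2) n in \<open>auto intro: less_trans\<close>)
    also have "\<dots> = e"
      by simp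
    finally have "u + v \<in> ball u e"
      by (simp add: dist_norm)
    then show ?thesis
      using e(2) u v(1) by (auto simp: abs_torus_add)
  qed
  then show ?thesis
    by blast
qed

text \<open>As in a metric space, an open set is the union of the closed sets of those points that keep a
  distance of \<open>1 / Suc n\<close> from its complement.\<close>

lemma open_delta02:
  assumes "open (U :: 'k::finite torus set)"
  shows "delta02 U"
proof -
  define K where "K n = - (\<Union>w\<in>- U. {x. small (1 / real (Suc n)) (x - w)})" for n
  have "closed (K n)" for n
    unfolding K_def by (intro closed_Compl open_UN ballI open_small)
  moreover have "U = (\<Union>n. K n)"
  proof (intro equalityI subsetI)
    fix x
    assume "x \<in> U"
    then obtain n where n: "\<And>t. small (1 / real (Suc n)) t \<Longrightarrow> x + t \<in> U"
      using open_contains_small[OF assms] by blast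
    have "x \<in> K n"
    proof (rule ccontr)
      assume "x \<notin> K n"
      then obtain w where w: "w \<notin> U" "small (1 / real (Suc n)) (x - w)"
        by (auto simp: K_def)
      then show False
        using n[OF small_minus[OF w(2)]] by simp
    qed
    then show "x \<in> (\<Union>n. K n)"
      by blast
  next
    fix x
    assume "x \<in> (\<Union>n. K n)"
    then obtain n where n: "x \<in> K n"
      by blast
    show "x \<in> U"
    proof (rule ccontr)
      assume "x \<notin> U"
      then have "\<not> small (1 / real (Suc n)) (x - x)"
        using n unfolding K_def by blast
      then show False
        by (simp add: small_0)
    qed
  qed
  moreover have "closed (- U)"
    using assms by (simp add: closed_Compl)
  ultimately show ?thesis
    by (metis delta02_iff fsigma_in_closed_UN closed_imp_fsigma_in closed_closedin)
qed

lemma delta02_translate: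
  assumes "delta02 A"
  shows "delta02 {x :: 'k::finite torus. x + t \<in> A}"
proof -
  have F: "fsigma_in euclidean {x. x + t \<in> B}" if B: "fsigma_in euclidean B" for B :: "'k torus set"
  proof -
    obtain C :: "nat \<Rightarrow> 'k torus set" where C: "\<And>n. closed (C n)" "\<Union>(range C) = B"
      using B by (auto simp: fsigma_in_ascending)
    have "closed {x. x + t \<in> C n}" for n
    proof -
      have "- {x. x + t \<in> C n} = {x. x + t \<in> - C n}"
        by auto
      then show ?thesis
        using open_translate[of "- C n" t] C(1) by (simp add: closed_def)
    qed
    moreover have "{x. x + t \<in> B} = (\<Union>n. {x. x + t \<in> C n})"
      using C(2) by auto
    ultimately show ?thesis
      by (simp add: fsigma_in_closed_UN)
  qed
  have "- {x. x + t \<in> A} = {x. x + t \<in> - A}"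
    by auto
  then show ?thesis
    using F[of A] F[of "- A"] assms by (simp add: delta02_iff)
qed

section \<open>The Schreier graph of an action by free translations\<close>

definition cube :: "nat \<Rightarrow> (int ^ 'd::finite) set" where
  "cube n = {g. \<forall>i. \<bar>g $ i\<bar> \<le> int n}"

lemma zero_cube [simp]: "0 \<in> cube n"
  by (simp add: cube_def)

lemma cube_0: "g \<in> cube 0 \<longleftrightarrow> g = 0"
  by (simp add: cube_def vec_eq_iff)

lemma uminus_cube: "g \<in> cube n \<Longrightarrow> - g \<in> cube n"
  by (simp add: cube_def)

lemma add_cube: "g \<in> cube m \<Longrightarrow> h \<in> cube n \<Longrightarrow> g + h \<in> cube (m + n)"
  unfolding cube_def by (auto intro!: order.trans[OF abs_triangle_ineq] add_mono)

lemma diff_cube: "g \<in> cube m \<Longrightarrow> h \<in> cube n \<Longrightarrow> g - h \<in> cube (m + n)"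
  using add_cube[OF _ uminus_cube, of g m h n] by simp

lemma finite_cube: "finite (cube n :: (int ^ 'd::finite) set)"
proof -
  have "cube n \<subseteq> vec_lambda ` ((UNIV :: 'd set) \<rightarrow>\<^sub>E {- int n..int n})"
  proof
    fix g :: "int ^ 'd"
    assume "g \<in> cube n"
    then have "vec_nth g \<in> UNIV \<rightarrow>\<^sub>E {- int n..int n}"
      by (auto simp: cube_def abs_le_iff minus_le_iff)
    then show "g \<in> vec_lambda ` ((UNIV :: 'd set) \<rightarrow>\<^sub>E {- int n..int n})"
      by (metis image_eqI vec_nth_inverse)
  qed
  then show ?thesis
    by (rule finite_subset) (intro finite_imageI finite_PiE; simp)
qed

lemma sup_sphere_iff: "g \<in> sup_sphere \<longleftrightarrow> g \<in> cube 1 \<and> g \<noteq> 0"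
proof -
  have fin: "finite (range (\<lambda>i. \<bar>g $ i\<bar>))" "range (\<lambda>i. \<bar>g $ i\<bar>) \<noteq> {}"
    by auto
  have "g \<in> sup_sphere \<longleftrightarrow> (\<forall>i. \<bar>g $ i\<bar> \<le> 1) \<and> (\<exists>i. \<bar>g $ i\<bar> = 1)"
    unfolding sup_sphere_def using Max_eq_iff[OF fin, of 1] by auto
  also have "\<dots> \<longleftrightarrow> (\<forall>i. \<bar>g $ i\<bar> \<le> 1) \<and> g \<noteq> 0"
  proof (rule conj_cong[OF refl])
    assume "\<forall>i. \<bar>g $ i\<bar> \<le> 1"
    then have "\<bar>g $ i\<bar> \<le> 1" for i
      by blast
    then have "\<bar>g $ i\<bar> = 1 \<longleftrightarrow> g $ i \<noteq> 0" for i
      by (smt (verit))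
    then show "(\<exists>i. \<bar>g $ i\<bar> = 1) \<longleftrightarrow> g \<noteq> 0"
      by (simp add: vec_eq_iff)
  qed
  finally show ?thesis
    by (simp add: cube_def)
qed

locale free_translations =
  fixes \<tau> :: "int ^ 'd::finite \<Rightarrow> 'k::finite torus"
  assumes add: "\<tau> (g + h) = \<tau> g + \<tau> h"
    and free: "\<tau> g = 0 \<Longrightarrow> g = 0"
begin

lemma zero [simp]: "\<tau> 0 = 0"
  using add[of 0 0] by simp

lemma minus: "\<tau> (- g) = - \<tau> g"
  using add[of g "- g"] by (simp add: eq_neg_iff_add_eq_0 add.commute)

lemma diff: "\<tau> (g - h) = \<tau> g - \<tau> h"
  using add[of g "- h"] by (simp add: minus)

definition near :: "nat \<Rightarrow> 'k torus \<Rightarrow> 'k torus \<Rightarrow> bool" where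
  "near n x y \<longleftrightarrow> (\<exists>g\<in>cube n. y = x + \<tau> g)"

sublocale coarse_space near
proof
  show "near n x x" for n x
    unfolding near_def by (rule bexI[of _ 0]) auto
  show "near n y x" if xy: "near n x y" for n x y
  proof -
    obtain g where g: "g \<in> cube n" "y = x + \<tau> g"
      using xy by (auto simp: near_def)
    then have "- g \<in> cube n" "x = y + \<tau> (- g)"
      by (simp_all add: uminus_cube minus)
    then show ?thesis
      unfolding near_def by blast
  qed
  show "near (m + n) x z" if "near m x y" "near n y z" for m n x y z
  proof -
    obtain g where "g \<in> cube m" "y = x + \<tau> g"
      using \<open>near m x y\<close> by (auto simp: near_def)
    moreover obtain h where "h \<in> cube n" "z = y + \<tau> h"
      using \<open>near n y z\<close> by (auto simp: near_def)
    ultimately have "g + h \<in> cube (m + n)" "z = x + \<tau> (g + h)"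
      by (simp_all add: add_cube add add.assoc)
    then show ?thesis
      unfolding near_def by blast
  qed
qed

lemma near_shift: "near n x y \<Longrightarrow> near n (x + t) (y + t)"
  unfolding near_def by (metis add.assoc add.commute)

lemma thick_translates: "thick n A = (\<Union>g\<in>cube n. {x. x + \<tau> g \<in> A})"
  by (auto simp: thick_def near_def)

lemma open_thick: "open A \<Longrightarrow> open (thick n A)"
  unfolding thick_translates by (intro open_UN ballI open_translate)

text \<open>Subtracting the sign of each coordinate lowers the norm of a nonzero group element by one, and the vector of
  signs is a generator.\<close>

lemma near_Suc:
  assumes "near (Suc n) x y"
  shows "near n x y \<or> (\<exists>z. near n x z \<and> (\<exists>h\<in>sup_sphere. y = z + \<tau> h))"
proof -
  obtain g where g: "g \<in> cube (Suc n)" "y = x + \<tau> g"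
    using assms by (auto simp: near_def)
  show ?thesis
  proof (cases "g = 0")
    case True
    then show ?thesis
      using g by simp
  next
    case False
    define h :: "int ^ 'd" where "h = (\<chi> i. sgn (g $ i))"
    have "\<bar>g $ i - sgn (g $ i)\<bar> \<le> int n" for i
    proof -
      have "\<bar>g $ i\<bar> \<le> 1 + int n"
        using g(1) by (simp add: cube_def)
      then show ?thesis
        by (cases "g $ i" "0 :: int" rule: linorder_cases) auto
    qed
    then have "g - h \<in> cube n"
      by (simp add: cube_def h_def)
    moreover have "h \<in> sup_sphere"
      using False by (auto simp: sup_sphere_iff cube_def h_def vec_eq_iff abs_sgn_eq sgn_eq_0_iff)
    moreover have "y = x + \<tau> (g - h) + \<tau> h"
      by (simp add: g(2) diff)
    ultimately show ?thesis
      unfolding near_def by blast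
  qed
qed

lemma gdist_schreier_iff:
  assumes act: "\<And>g p. act g p = p + \<tau> g"
  shows "gdist (schreier_graph act sup_sphere) x y \<le> enat n \<longleftrightarrow> near n x y"
proof -
  let ?G = "schreier_graph act sup_sphere"
  have G: "(p, r) \<in> ?G \<longleftrightarrow> (\<exists>h\<in>sup_sphere. r = p + \<tau> h)" for p r
    by (auto simp: schreier_graph_def act)
  have near: "near m x y" if "(x, y) \<in> ?G ^^ m" for m x y
    using that
  proof (induction m arbitrary: y)
    case (Suc m)
    then obtain z where z: "near m x z" "(z, y) \<in> ?G"
      by auto
    then have "near 1 z y"
      using G by (auto simp: near_def sup_sphere_iff)
    then show ?case
      using near_trans[OF z(1), of 1 y] by simp
  qed simp
  have walk: "\<exists>m\<le>n. (x, y) \<in> ?G ^^ m" if "near n x y" for n x y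
    using that
  proof (induction n arbitrary: y)
    case 0
    then have "x = y"
      by (simp add: near_def cube_0)
    then show ?case
      by simp
  next
    case (Suc n)
    from near_Suc[OF Suc.prems] show ?case
    proof
      assume "near n x y"
      then show ?thesis
        using Suc.IH le_Suc_eq by blast
    next
      assume "\<exists>z. near n x z \<and> (\<exists>h\<in>sup_sphere. y = z + \<tau> h)"
      then obtain z m where "m \<le> n" "(x, z) \<in> ?G ^^ m" "(z, y) \<in> ?G"
        using Suc.IH G by blast
      then show ?thesis
        by (intro exI[of _ "Suc m"]) auto
    qed
  qed
  show ?thesis
  proof
    assume "gdist ?G x y \<le> enat n"
    then have "(INF m\<in>{m. (x, y) \<in> ?G ^^ m}. enat m) < enat (Suc n)"
      unfolding gdist_def by (rule le_less_trans) simp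
    then obtain m where "(x, y) \<in> ?G ^^ m" "m < Suc n"
      unfolding INF_less_iff by auto
    then show "near n x y"
      using near_mono[OF near] by simp
  next
    assume "near n x y"
    then obtain m where m: "m \<le> n" "(x, y) \<in> ?G ^^ m"
      using walk by blast
    then have "gdist ?G x y \<le> enat m"
      unfolding gdist_def by (intro INF_lower) auto
    then show "gdist ?G x y \<le> enat n"
      by (rule order.trans) (simp add: m(1))
  qed
qed

section \<open>Complexity of the layers\<close>

lemma delta02_pieces:
  assumes "\<And>n a. open (U n a)"
  shows "delta02 (pieces U \<rho> s n)"
proof -
  have "open (future U \<rho> m a)" "open (deep_future U \<rho> m a)" for m a
    unfolding future_def deep_future_def using assms by (auto intro: open_thick)
  then have "delta02 (piece U \<rho> s n a)" for a
    unfolding piece_def using assms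
    by (intro delta02_Diff delta02_Int delta02_UN open_delta02 open_thick) auto
  then show ?thesis
    unfolding pieces_def by (intro delta02_UN) auto
qed

text \<open>Chains of links do not leave a bounded ball, so that they can be translated between points that
  see the same part of \<open>W\<close> in that ball.\<close>

lemma links_local:
  assumes bound: "\<And>u v. (u, v) \<in> (links q W)\<^sup>* \<Longrightarrow> near E u v"
    and agree: "\<And>h. h \<in> cube (E + q) \<Longrightarrow> x + \<tau> h \<in> W \<longleftrightarrow> y + \<tau> h \<in> W"
    and path: "(x, x + \<tau> g) \<in> (links q W)\<^sup>*"
  shows "(y, y + \<tau> g) \<in> (links q W)\<^sup>*"
proof -
  have "(y, z + (y - x)) \<in> (links q W)\<^sup>*" if "(x, z) \<in> (links q W)\<^sup>*" for z
    using that
  proof induction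
    case (step z z')
    obtain g where g: "g \<in> cube E" "z = x + \<tau> g"
      using bound[OF step(1)] by (auto simp: near_def)
    obtain w where w: "w \<in> W" "near q z w" "near q w z'"
      using step(2) by (auto simp: links_def)
    obtain h where h: "h \<in> cube q" "w = z + \<tau> h"
      using w(2) by (auto simp: near_def)
    have "w = x + \<tau> (g + h)"
      by (simp add: g(2) h(2) add add.assoc)
    then have "w + (y - x) \<in> W"
      using agree[OF add_cube[OF g(1) h(1)]] w(1) by (simp add: algebra_simps)
    moreover have "near q (z + (y - x)) (w + (y - x))" "near q (w + (y - x)) (z' + (y - x))"
      using near_shift w(2,3) by blast+
    ultimately have "(z + (y - x), z' + (y - x)) \<in> links q W"
      by (auto simp: links_def)
    then show ?case
      using step(3) by (meson rtrancl.rtrancl_into_rtrancl)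
  qed simp
  from this[OF path] show ?thesis
    by (simp add: add.commute)
qed

lemma delta02_absorb:
  assumes bound: "\<And>u v. (u, v) \<in> (links q W)\<^sup>* \<Longrightarrow> near E u v"
    and W: "delta02 W" and S: "delta02 S"
  shows "delta02 (absorb q W S)"
proof -
  let ?L = "(links q W)\<^sup>*"
  have connected: "delta02 {x. (x, x + \<tau> g) \<in> ?L}" for g
  proof (rule delta02_determined)
    show "finite (cube (E + q) :: (int ^ 'd) set)"
      by (rule finite_cube)
    show "delta02 {x. x + \<tau> h \<in> W}" for h
      using W by (rule delta02_translate)
    show "y \<in> {x. (x, x + \<tau> g) \<in> ?L}"
      if "\<And>h. h \<in> cube (E + q) \<Longrightarrow> x \<in> {x. x + \<tau> h \<in> W} \<longleftrightarrow> y \<in> {x. x + \<tau> h \<in> W}"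
        and "x \<in> {x. (x, x + \<tau> g) \<in> ?L}" for x y
      using links_local[OF bound, where x = x and y = y and g = g] that by simp
  qed
  have sym: "sym ?L"
    by (intro sym_rtrancl sym_links)
  have "absorb q W S = (\<Union>g\<in>cube E. {x. (x, x + \<tau> g) \<in> ?L} \<inter> {x. x + \<tau> g \<in> S})"
  proof (intro equalityI subsetI)
    fix x
    assume "x \<in> absorb q W S"
    then obtain s where s: "s \<in> S" "(x, s) \<in> ?L"
      using sym by (auto simp: absorb_def dest: symD)
    then show "x \<in> (\<Union>g\<in>cube E. {x. (x, x + \<tau> g) \<in> ?L} \<inter> {x. x + \<tau> g \<in> S})"
      using bound[OF s(2)] by (auto simp: near_def)
  qed (use sym in \<open>auto simp: absorb_def dest: symD\<close>)
  moreover have "delta02 \<dots>"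
    by (intro delta02_UN finite_cube delta02_Int connected delta02_translate S)
  ultimately show ?thesis
    by simp
qed

lemma delta02_layer:
  assumes bound: "\<And>m u v. (u, v) \<in> (links q (absorbed q S m))\<^sup>* \<Longrightarrow> near (E m) u v"
    and S: "\<And>m. delta02 (S m)"
  shows "delta02 (layer q S m)"
proof -
  have "delta02 (absorbed q S m)" for m
    by (induction m) (auto intro!: delta02_Un delta02_absorb[OF bound] S)
  then show ?thesis
    unfolding layer_def by (intro delta02_absorb[OF bound] S)
qed

section \<open>Open covers with a scale-independent number of colours\<close>

end

text \<open>A finite graph of degree at most \<open>N\<close> has a proper colouring by \<open>0, \<dots>, N\<close>.\<close>

lemma greedy_coloring:
  assumes "finite C" and sym: "symp adj"
    and degree: "\<And>x. x \<in> C \<Longrightarrow> card {y\<in>C. adj x y} \<le> N"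
  shows "\<exists>col. (\<forall>x\<in>C. col x \<le> N) \<and> (\<forall>x\<in>C. \<forall>y\<in>C. x \<noteq> y \<and> adj x y \<longrightarrow> col x \<noteq> col y)"
  using assms(1) degree
proof (induction C rule: finite_induct)
  case (insert c C)
  have degree': "card {y\<in>C. adj x y} \<le> N" if "x \<in> insert c C" for x
  proof -
    have "card {y\<in>C. adj x y} \<le> card {y\<in>insert c C. adj x y}"
      using insert.hyps(1) by (intro card_mono) auto
    then show ?thesis
      using insert.prems[OF that] by simp
  qed
  then obtain col where col: "\<forall>x\<in>C. col x \<le> N"
    "\<forall>x\<in>C. \<forall>y\<in>C. x \<noteq> y \<and> adj x y \<longrightarrow> col x \<noteq> col y"
    and c: "card {y\<in>C. adj c y} \<le> N"
    using insert.IH[OF degree'] degree'[of c] by auto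
  have fin: "finite {y\<in>C. adj c y}"
    using insert.hyps(1) by simp
  have "card (col ` {y\<in>C. adj c y}) < card {..N}"
    using card_image_le[OF fin, of col] c by simp
  then have "\<not> {..N} \<subseteq> col ` {y\<in>C. adj c y}"
    using card_mono[OF finite_imageI[OF fin], of "{..N}" col] by linarith
  then obtain k where "k \<le> N" "\<And>y. y \<in> C \<Longrightarrow> adj c y \<Longrightarrow> col y \<noteq> k"
    by blast
  then show ?case
    using col insert.hyps(2) sympD[OF sym] by (intro exI[of _ "col(c := k)"]) auto
qed simp

context free_translations
begin

text \<open>Closeness in two directions at once: along the orbit up to \<open>n\<close>, and across the orbits
  up to \<open>e\<close>.\<close>

definition close :: "nat \<Rightarrow> real \<Rightarrow> 'k torus \<Rightarrow> 'k torus \<Rightarrow> bool" where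
  "close n e x y \<longleftrightarrow> (\<exists>g\<in>cube n. small e (x + \<tau> g - y))"

lemma close_refl: "0 < e \<Longrightarrow> close n e x x"
  unfolding close_def by (intro bexI[of _ 0]) (auto simp: small_0)

lemma close_sym: "close n e x y \<Longrightarrow> close n e y x"
proof -
  assume "close n e x y"
  then obtain g where g: "g \<in> cube n" "small e (x + \<tau> g - y)"
    by (auto simp: close_def)
  have "- (x + \<tau> g - y) = y + \<tau> (- g) - x"
    by (simp add: minus)
  then show ?thesis
    unfolding close_def using small_minus[OF g(2)] uminus_cube[OF g(1)] by (metis)
qed

lemma symp_close: "symp (close n e)"
  by (rule sympI) (rule close_sym)

lemma close_trans:
  assumes "close m e x y" "close n f y z"
  shows "close (m + n) (e + f) x z"
proof -
  obtain g h where "g \<in> cube m" "small e (x + \<tau> g - y)" "h \<in> cube n" "small f (y + \<tau> h - z)"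
    using assms by (auto simp: close_def)
  moreover have "(x + \<tau> g - y) + (y + \<tau> h - z) = x + \<tau> (g + h) - z"
    by (simp add: add algebra_simps)
  ultimately show ?thesis
    unfolding close_def by (metis add_cube small_add)
qed

lemma close_near:
  assumes "close m e x y" "near n y z"
  shows "close (m + n) e x z"
proof -
  obtain g h where "g \<in> cube m" "small e (x + \<tau> g - y)" "h \<in> cube n" "z = y + \<tau> h"
    using assms by (auto simp: close_def near_def)
  moreover from this have "x + \<tau> (g + h) - z = x + \<tau> g - y"
    by (simp add: add algebra_simps)
  ultimately show ?thesis
    unfolding close_def by (metis add_cube)
qed

lemma open_close: "open {x. close n e x c}"
proof -
  have "{x. close n e x c} = (\<Union>g\<in>cube n. {x. small e (x - (c - \<tau> g))})"
    by (auto simp: close_def algebra_simps)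
  then show ?thesis
    by (simp add: open_UN open_small)
qed

text \<open>Cells of a fixed size relative to the closeness parameters; the range from \<open>-4\<close> to \<open>4\<close> suffices
  for points at three times the first and four times the second parameter.\<close>

definition codes :: "(('d \<Rightarrow> int) \<times> ('k \<Rightarrow> int)) set" where
  "codes = (UNIV \<rightarrow>\<^sub>E {-4..4}) \<times> (UNIV \<rightarrow>\<^sub>E {-4..4})"

lemma finite_codes: "finite codes"
  unfolding codes_def by (intro finite_cartesian_product finite_PiE) auto

text \<open>Dividing the orbit coordinates by \<open>Suc R\<close> and the transverse ones by \<open>e\<close> gives every centre near
  \<open>x\<close> a code.  Centres with the same code are \<open>(R, e)\<close>-close, hence equal.  The bound does not depend
  on \<open>R\<close>, \<open>e\<close> and \<open>x\<close>.\<close>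

lemma packing:
  assumes e: "0 < e" and sep: "\<And>c c'. c \<in> C \<Longrightarrow> c' \<in> C \<Longrightarrow> close R e c c' \<Longrightarrow> c = c'"
  shows "card {c\<in>C. close (3 * R) (4 * e) x c} \<le> card codes"
proof -
  let ?B = "{c\<in>C. close (3 * R) (4 * e) x c}"
  have "\<forall>c\<in>?B. \<exists>p. fst p \<in> cube (3 * R) \<and> x + \<tau> (fst p) - c = abs_torus (snd p) \<and>
      (\<forall>i. \<bar>snd p $ i\<bar> < 4 * e)"
    by (auto simp: close_def small_def)
  from bchoice[OF this] obtain f where f: "\<forall>c\<in>?B. fst (f c) \<in> cube (3 * R) \<and>
      x + \<tau> (fst (f c)) - c = abs_torus (snd (f c)) \<and> (\<forall>i. \<bar>snd (f c) $ i\<bar> < 4 * e)" ..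
  define g where "g c = fst (f c)" for c
  define v where "v c = snd (f c)" for c
  have gv: "g c \<in> cube (3 * R)" "x + \<tau> (g c) - c = abs_torus (v c)" "\<bar>v c $ i\<bar> < 4 * e"
    if "c \<in> ?B" for c i
    using f that unfolding g_def v_def by blast+
  define code where "code c = ((\<lambda>i. g c $ i div int (Suc R)), (\<lambda>i. \<lfloor>v c $ i / e\<rfloor>))" for c
  have code: "code ` ?B \<subseteq> codes"
  proof
    fix p
    assume "p \<in> code ` ?B"
    then obtain c where c: "c \<in> ?B" "p = code c"
      by blast
    have "-4 \<le> g c $ i div int (Suc R) \<and> g c $ i div int (Suc R) \<le> 4" for i
    proof -
      have "\<bar>g c $ i\<bar> \<le> 3 * int R"
        using gv(1)[OF c(1)] by (auto simp: cube_def)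
      then have "-4 * int (Suc R) \<le> g c $ i" "g c $ i \<le> 4 * int (Suc R)"
        by auto
      then have "-4 * int (Suc R) div int (Suc R) \<le> g c $ i div int (Suc R)"
        "g c $ i div int (Suc R) \<le> 4 * int (Suc R) div int (Suc R)"
        by (intro zdiv_mono1; simp)+
      then show ?thesis
        unfolding nonzero_mult_div_cancel_right[OF of_nat_neq_0] by simp
    qed
    moreover have "-4 \<le> \<lfloor>v c $ i / e\<rfloor> \<and> \<lfloor>v c $ i / e\<rfloor> \<le> 4" for i
    proof -
      have "-4 * e \<le> v c $ i" "v c $ i \<le> 4 * e"
        using gv(3)[OF c(1), of i] by auto
      then have "-4 \<le> v c $ i / e" "v c $ i / e \<le> 4"
        using e by (simp_all add: field_simps)
      then show ?thesis
        by (simp add: le_floor_iff floor_le_iff)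
    qed
    ultimately show "p \<in> codes"
      unfolding c(2) code_def codes_def by auto
  qed
  have inj: "inj_on code ?B"
  proof (rule inj_onI)
    fix c c'
    assume c: "c \<in> ?B" "c' \<in> ?B" "code c = code c'"
    have "\<bar>g c $ i - g c' $ i\<bar> \<le> int R" for i
    proof -
      have "g c $ i div int (Suc R) = g c' $ i div int (Suc R)"
        using c(3) by (auto simp: code_def dest: fun_cong[where x = i])
      then have "g c $ i - g c' $ i = g c $ i mod int (Suc R) - g c' $ i mod int (Suc R)"
        by (simp add: minus_div_mult_eq_mod[symmetric] del: of_nat_Suc)
      moreover have "0 \<le> z mod int (Suc R) \<and> z mod int (Suc R) < int (Suc R)" for z
        by simp
      ultimately show ?thesis
        by (smt (verit) of_nat_Suc)
    qed
    then have "g c - g c' \<in> cube R"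
      by (simp add: cube_def)
    then have "g c' - g c \<in> cube R"
      using uminus_cube by fastforce
    moreover have "\<bar>v c' $ i - v c $ i\<bar> < e" for i
    proof -
      have "\<lfloor>v c $ i / e\<rfloor> = \<lfloor>v c' $ i / e\<rfloor>"
        using c(3) by (auto simp: code_def dest: fun_cong[where x = i])
      then have "\<bar>v c' $ i / e - v c $ i / e\<bar> < 1"
        by linarith
      then have "\<bar>(v c' $ i - v c $ i) / e\<bar> < 1"
        by (simp add: diff_divide_distrib)
      then show ?thesis
        using e by (simp add: abs_divide)
    qed
    moreover have "c + \<tau> (g c' - g c) - c' = abs_torus (v c' - v c)"
    proof -
      have "c + \<tau> (g c' - g c) - c' = (x + \<tau> (g c') - c') - (x + \<tau> (g c) - c)"
        by (simp add: diff algebra_simps)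
      then show ?thesis
        unfolding gv(2)[OF c(1)] gv(2)[OF c(2)] abs_torus_diff .
    qed
    ultimately have "close R e c c'"
      unfolding close_def small_def
      by (intro bexI[of _ "g c' - g c"] exI[of _ "v c' - v c"]) simp_all
    then show "c = c'"
      using sep c(1,2) by blast
  qed
  show ?thesis
    using card_inj_on_le[OF inj code finite_codes] .
qed

text \<open>Freeness enters here: the finitely many nonzero elements of a cube do not translate by \<open>0\<close>, and so
  their translations keep a common distance from \<open>0\<close>.\<close>

lemma uniform_separation: "\<exists>e>0. \<forall>g\<in>cube n. small e (\<tau> g) \<longrightarrow> g = 0"
proof -
  have "0 \<notin> \<tau> ` (cube n - {0})"
  proof
    assume "0 \<in> \<tau> ` (cube n - {0})"
    then obtain g where "g \<noteq> 0" "\<tau> g = 0"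
      by (metis DiffE imageE singletonI)
    then show False
      using free by blast
  qed
  then obtain e where e: "e > 0" "\<forall>t\<in>\<tau> ` (cube n - {0}). \<not> small e t"
    using not_small_uniform[OF finite_imageI[OF finite_Diff[OF finite_cube]]] by meson
  have "g = 0" if "g \<in> cube n" "small e (\<tau> g)" for g
    using e(2) that by (metis DiffI imageI singletonD)
  then show ?thesis
    using e(1) by (intro exI[of _ e]) simp
qed

text \<open>A maximal separated subset of a fine finite net; the net costs the factor two.\<close>

lemma separated_net:
  assumes "0 < e"
  shows "\<exists>C. finite C \<and> (\<forall>c\<in>C. \<forall>c'\<in>C. close R e c c' \<longrightarrow> c = c') \<and> (\<forall>x. \<exists>c\<in>C. close R (2 * e) x c)"
proof -
  obtain P :: "'k torus set" where P: "finite P" "\<And>t. \<exists>p\<in>P. small e (t - p)"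
    using finite_net[OF assms] by blast
  define sep where "sep C \<longleftrightarrow> (\<forall>c\<in>C. \<forall>c'\<in>C. close R e c c' \<longrightarrow> c = c')" for C
  define F where "F = {C \<in> Pow P. sep C}"
  have "finite F" "{} \<in> F"
    using P(1) by (simp_all add: F_def sep_def)
  then obtain C where "C \<in> F" and max: "\<forall>C'\<in>F. C \<subseteq> C' \<longrightarrow> C = C'"
    using finite_has_maximal[of F] by blast
  then have C: "C \<subseteq> P" "sep C"
    by (simp_all add: F_def)
  have "\<exists>c\<in>C. close R (2 * e) x c" for x
  proof -
    obtain p where p: "p \<in> P" "small e (x - p)"
      using P(2) by blast
    then have xp: "close 0 e x p"
      unfolding close_def by (intro bexI[of _ 0]) auto
    have "\<exists>c\<in>C. close R e p c"
    proof (rule ccontr)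
      assume no: "\<not> (\<exists>c\<in>C. close R e p c)"
      then have "sep (insert p C)"
        using C(2) close_sym unfolding sep_def by (metis insertE)
      then have "insert p C \<in> F"
        using C(1) p(1) by (simp add: F_def)
      then have "p \<in> C"
        using max by blast
      then show False
        using no close_refl[OF assms] by blast
    qed
    then obtain c where c: "c \<in> C" "close R e p c" ..
    have "close (0 + R) (e + e) x c"
      by (rule close_trans[OF xp c(2)])
    then have "close R (2 * e) x c"
      unfolding mult_2 add_0 .
    then show ?thesis
      using c(1) ..
  qed
  moreover have "finite C"
    using C(1) P(1) by (rule finite_subset)
  ultimately show ?thesis
    using C(2) unfolding sep_def by (intro exI[of _ C]) simp
qed

text \<open>A colour consists of the \<open>(R, 2 * e)\<close>-neighbourhoods of its centres.  Two such neighbourhoods that are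
  joined by a jump of length \<open>R\<close> have \<open>(3 * R, 4 * e)\<close>-close centres, and since distinct centres
  of one colour are never that close, adjacent points belong to the same centre \<open>c\<close>.  They even reach \<open>c\<close> through the same
  point of the orbit, because \<open>e\<close> is chosen so small that no nonzero group element of norm at
  most \<open>3 * R\<close> moves a point by less than \<open>4 * e\<close>.  So the chain stays within \<open>R\<close> of that point.\<close>

lemma open_cover:
  shows "\<exists>U. (\<forall>a. open (U a)) \<and> (\<forall>x. \<exists>a<Suc (card codes). x \<in> U a) \<and> (\<forall>a. bounded_at R (2 * R) (U a))"
proof -
  obtain e0 where e0: "e0 > 0" "\<forall>g\<in>cube (3 * R). small e0 (\<tau> g) \<longrightarrow> g = 0"
    using uniform_separation[of "3 * R"] by (elim exE conjE)
  define e where "e = e0 / 5"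
  have e: "e > 0" "4 * e < e0"
    using e0(1) by (auto simp: e_def)
  obtain C where C: "finite C" "\<forall>c\<in>C. \<forall>c'\<in>C. close R e c c' \<longrightarrow> c = c'"
    "\<forall>x. \<exists>c\<in>C. close R (2 * e) x c"
    using separated_net[OF e(1), of R] by (elim exE conjE)
  have degree: "card {c'\<in>C. close (3 * R) (4 * e) c c'} \<le> card codes" for c
    by (rule packing[OF e(1)]) (use C(2) in simp)
  obtain col :: "'k torus \<Rightarrow> nat" where col: "\<forall>c\<in>C. col c \<le> card codes"
    "\<forall>c\<in>C. \<forall>c'\<in>C. c \<noteq> c' \<and> close (3 * R) (4 * e) c c' \<longrightarrow> col c \<noteq> col c'"
    using greedy_coloring[of C "close (3 * R) (4 * e)" "card codes", OF C(1) symp_close degree] by (elim exE conjE)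
  define U where "U a = (\<Union>c\<in>{c\<in>C. col c = a}. {x. close R (2 * e) x c})" for a
  have "open (U a)" for a
    unfolding U_def by (intro open_UN ballI open_close)
  moreover have "\<exists>a<Suc (card codes). x \<in> U a" for x
  proof -
    obtain c where c: "c \<in> C" "close R (2 * e) x c"
      using C(3) by auto
    then have "x \<in> U (col c)" "col c < Suc (card codes)"
      using col(1) by (auto simp: U_def less_Suc_eq_le)
    then show ?thesis
      by auto
  qed
  moreover have "bounded_at R (2 * R) (U a)" for a
    unfolding bounded_at_def
  proof (intro allI impI)
    fix x y
    assume xy: "(x, y) \<in> (steps R (U a))\<^sup>*"
    show "near (2 * R) x y"
    proof (cases "x \<in> U a")
      case True
      then obtain c g where c: "c \<in> C" "col c = a" and g: "g \<in> cube R" "small (2 * e) (x + \<tau> g - c)"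
        by (auto simp: U_def close_def)
      \<comment> \<open>The point \<open>x + \<tau> g\<close> of the orbit next to \<open>c\<close> is the same for all points of the chain.\<close>
      have "\<exists>h\<in>cube R. y + \<tau> h = x + \<tau> g"
        using xy
      proof induction
        case base
        then show ?case
          using g(1) by blast
      next
        case (step y z)
        obtain h where h: "h \<in> cube R" "y + \<tau> h = x + \<tau> g"
          using step(3) by blast
        obtain k where k: "k \<in> cube R" "z = y + \<tau> k"
          using step(2) by (auto simp: steps_def near_def)
        obtain c' h' where c': "c' \<in> C" "col c' = a" and h': "h' \<in> cube R" "small (2 * e) (z + \<tau> h' - c')"
          using step(2) by (auto simp: steps_def U_def close_def)
        have "close R (2 * e) y c"
          unfolding close_def by (rule bexI[OF _ h(1)]) (simp add: h(2) g(2))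
        moreover have "close R (2 * e) z c'"
          using h' unfolding close_def by (intro bexI[of _ h'])
        ultimately have "close (R + R + R) (2 * e + 2 * e) c c'"
          using step(2) by (intro close_trans[OF close_near[OF close_sym]]) (auto simp: steps_def)
        moreover have "R + R + R = 3 * R" "2 * e + 2 * e = 4 * e"
          by simp_all
        ultimately have "close (3 * R) (4 * e) c c'"
          by metis
        then have "c' = c"
          using col(2)[rule_format, of c c'] c c' by auto
        then have "small (2 * e + 2 * e) ((z + \<tau> h' - c) + - (y + \<tau> h - c))"
          by (intro small_add small_minus) (use h'(2) g(2) h(2) \<open>c' = c\<close> in simp_all)
        moreover have "(z + \<tau> h' - c) + - (y + \<tau> h - c) = \<tau> (k + h' - h)"
          by (simp add: k(2) add diff algebra_simps)
        ultimately have "small e0 (\<tau> (k + h' - h))"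
          using e(2) small_mono[of "4 * e" _ e0] by auto
        moreover have "k + h' - h \<in> cube (3 * R)"
          using diff_cube[OF add_cube[OF k(1) h'(1)] h(1)] by (simp add: numeral_eq_Suc add_ac)
        ultimately have "h = k + h'"
          using e0(2)[rule_format, of "k + h' - h"] by simp
        then have "z + \<tau> h' = x + \<tau> g"
          using h(2) k(2) by (simp add: add add.assoc)
        then show ?case
          using h'(1) by blast
      qed
      then obtain h where h: "h \<in> cube R" "y + \<tau> h = x + \<tau> g"
        by blast
      have "y = x + \<tau> (g - h)"
        using h(2) by (simp add: diff algebra_simps)
      moreover have "g - h \<in> cube (2 * R)"
        using diff_cube[OF g(1) h(1)] by (simp add: mult_2)
      ultimately show ?thesis
        by (auto simp: near_def)
    next
      case False
      then have "x = y"
        using xy by (auto elim: converse_rtranclE simp: steps_def)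
      then show ?thesis
        by simp
    qed
  qed
  ultimately show ?thesis
    by blast
qed

end

section \<open>Toasts for free actions by translations\<close>

text \<open>The first component \<open>E\<close> bounds the chains of links through the layers before \<open>m\<close>, the second
  component is the sum of all \<open>\<rho> i\<close> with \<open>i < m\<close>.  The value \<open>\<rho> = 3 * E + 2 * q\<close> is the scale at which layer \<open>m\<close>
  has to be bounded for the absorption; \<open>2 * \<sigma>' + \<rho>\<close> is the scale of the cover from which it is selected,
  and twice that number bounds the components of the cover.\<close>

primrec reach :: "nat \<Rightarrow> nat \<Rightarrow> nat \<times> nat" where
  "reach q 0 = (0, 0)"
| "reach q (Suc m) = (case reach q m of (E, \<sigma>) \<Rightarrow>
     let \<rho> = 3 * E + 2 * q; \<sigma>' = \<sigma> + \<rho> in (2 * \<sigma>' + 2 * (2 * \<sigma>' + \<rho>) + 4 * E + 2 * q, \<sigma>'))"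

lemma (in free_translations) toast_exists:
  assumes act: "\<And>g p. act g p = p + \<tau> g"
  shows "\<exists>T. toast (schreier_graph act sup_sphere) q T \<and> (\<forall>n. delta02 (T n))"
proof -
  define s where "s = Suc (card codes)"
  define E where "E m = fst (reach q m)" for m
  define \<rho> where "\<rho> m = 3 * E m + 2 * q" for m
  define \<sigma> where "\<sigma> m = (\<Sum>i\<le>m. \<rho> i)" for m
  define R where "R m = 2 * \<sigma> m + \<rho> m" for m
  have sum: "snd (reach q m) = (\<Sum>i<m. \<rho> i)" for m
    by (induction m) (auto simp: case_prod_beta Let_def \<rho>_def E_def)
  have E_Suc: "E (Suc m) = (2 * \<sigma> m + 2 * R m) + 4 * E m + 2 * q" for m
    using sum[of m]
    by (simp add: E_def R_def \<sigma>_def case_prod_beta Let_def \<rho>_def lessThan_Suc_atMost[symmetric])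
  have "\<forall>n. \<exists>U. (\<forall>a. open (U a)) \<and> (\<forall>x. \<exists>a<s. x \<in> U a) \<and> (\<forall>a. bounded_at (R n) (2 * R n) (U a))"
    using open_cover unfolding s_def by blast
  then obtain U where U: "\<And>n a. open (U n a)" "\<And>n x. \<exists>a<s. x \<in> U n a"
    "\<And>n a. bounded_at (R n) (2 * R n) (U n a)"
    by metis
  define S where "S = pieces U \<rho> s"
  have "bounded_at (\<rho> m) (2 * \<sigma> m + 2 * R m) (S m)" for m
    unfolding S_def \<sigma>_def by (rule pieces_bounded) (use U(3) in \<open>simp add: R_def \<sigma>_def\<close>)
  then have bound: "near (E m) u v" if "(u, v) \<in> (links q (absorbed q S m))\<^sup>*" for m u v
    using links_absorbed_bound[of E q "\<lambda>m. 2 * \<sigma> m + 2 * R m" S u v m] E_Suc that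
    by (simp add: \<rho>_def E_def)
  have "toast (schreier_graph act sup_sphere) q (layer q S)"
    by (rule toast_layer[OF gdist_schreier_iff[OF act] _ bound]) (auto simp: S_def pieces_cover U(2))
  moreover have "delta02 (layer q S n)" for n
    by (rule delta02_layer[OF bound]) (auto simp: S_def intro!: delta02_pieces U(1))
  ultimately show ?thesis
    by blast
qed

theorem theorem1p7:
  fixes act :: "int ^ 'd::finite \<Rightarrow> 'k::finite torus \<Rightarrow> 'k torus"
    and x :: "'d \<Rightarrow> 'k torus"
    and q :: nat
  assumes "free_action act"
    and "\<And>i p. act (axis i 1) p = p + x i"
  shows "\<exists>T :: nat \<Rightarrow> 'k torus set.
           toast (schreier_graph act sup_sphere) q T \<and> (\<forall>n. delta02 (T n))"
proof -
  have act_0: "act 0 p = p" and act_add: "act (g + h) p = act g (act h p)"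
    and act_free: "act g p = p \<Longrightarrow> g = 0" for g h p
    using assms(1) by (auto simp: free_action_def group_action_def)
  \<comment> \<open>The group elements that act by translations form a subgroup, which contains the generators.\<close>
  define H where "H = {g. \<forall>p. act g p = p + act g 0}"
  have H: "act g p = p + act g 0" if "g \<in> H" for g p
    using that unfolding H_def by blast
  have H_0: "0 \<in> H"
    by (simp add: H_def act_0)
  have H_add: "g + h \<in> H" if "g \<in> H" "h \<in> H" for g h
  proof -
    have "act (g + h) p = p + act (g + h) 0" for p
    proof -
      have "act (g + h) p = (p + act h 0) + act g 0"
        unfolding act_add by (subst H[OF that(2)], subst H[OF that(1)]) (rule refl)
      moreover have "act (g + h) 0 = act h 0 + act g 0"
        unfolding act_add by (rule H[OF that(1)])
      ultimately show ?thesis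
        by (simp add: add.assoc)
    qed
    then show ?thesis
      unfolding H_def by blast
  qed
  have H_minus: "- g \<in> H" if "g \<in> H" for g
  proof -
    have "act (- g) p = p - act g 0" for p
    proof -
      have "p = act g (act (- g) p)"
        using act_add[of g "- g" p] act_0 by simp
      also have "\<dots> = act (- g) p + act g 0"
        by (rule H[OF that])
      finally show ?thesis
        by (metis eq_diff_eq)
    qed
    then show ?thesis
      by (simp add: H_def)
  qed
  have H_axis: "axis i k \<in> H" for i k
  proof (induction k rule: int_induct[where k = 0])
    case base
    then show ?case
      using H_0 by (simp add: axis_def vec_eq_iff zero_vec_def)
  next
    case (step1 k)
    have "axis i 1 \<in> H"
      by (simp add: H_def assms(2))
    moreover have "axis i (k + 1) = axis i k + (axis i 1 :: int ^ 'd)"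
      by (simp add: axis_def vec_eq_iff)
    ultimately show ?case
      using H_add step1 by simp
  next
    case (step2 k)
    have "axis i 1 \<in> H"
      by (simp add: H_def assms(2))
    then have "axis i k + - axis i 1 \<in> H"
      using H_add H_minus step2 by blast
    moreover have "axis i (k - 1) = axis i k + - (axis i 1 :: int ^ 'd)"
      by (simp add: axis_def vec_eq_iff)
    ultimately show ?case
      by metis
  qed
  have H_all: "g \<in> H" for g
  proof -
    have "(\<Sum>i\<in>I. axis i (g $ i)) \<in> H" if "finite I" for I
      using that by (induction I rule: finite_induct) (auto simp: H_0 H_add H_axis)
    moreover have "g = (\<Sum>i\<in>UNIV. axis i (g $ i))"
      by (simp add: vec_eq_iff axis_def)
    ultimately show ?thesis
      by (metis finite)
  qed
  then have act: "act g p = p + act g 0" for g p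
    using H by blast
  interpret free_translations "\<lambda>g. act g 0"
  proof
    show "act (g + h) 0 = act g 0 + act h 0" for g h
      unfolding act_add by (subst act) (rule add.commute)
    show "g = 0" if "act g 0 = 0" for g
      using act_free that by blast
  qed
  show ?thesis
    by (rule toast_exists) (rule act)
qed

end
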